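(* Let $k\ge 2$ be an integer. Every signed bipartite graph $(G,\Sigma)$ of unbalanced-girth at least $2k$ whose underlying graph $G$ is $K_4$-minor-free admits a homomorphism to the signed projective cube $SPC(2k-1)$.
   Context: All graphs are finite and simple. A signed graph $(G,\Sigma)$ is a graph $G$ with a set $\Sigma\subseteq E(G)$ of negative edges; the other edges are positive. It is a signed bipartite graph if $G$ is bipartite. A closed walk is balanced if the product of the signs of its edges, counted with repetition, is $+$, and unbalanced otherwise. The unbalanced-girth of $(G,\Sigma)$ is the length of a shortest unbalanced cycle, and $\infty$ if there is none. A homomorphism of $(G,\Sigma)$ to $(H,\Pi)$ is a map $\varphi:V(G)\to V(H)$ that sends edges of $G$ to edges of $H$ and such that the image of each closed walk of $(G,\Sigma)$ is a closed walk of $(H,\Pi)$ with the same balance. Signed projective cube: for $d\ge 2$, $SPC(d)$ is the signed graph with vertex set $\mathbb{Z}_2^{d}$ where $u,v$ are adjacent if and only if $u-v\in\{e_1,\dots,e_d,J\}$, with $e_1,\dots,e_d$ the standard basis and $J$ the all-$1$ vector; an edge is negative if $u-v=J$ and positive otherwise. *)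

theory Defs
  imports Main "HOL-Library.Extended_Nat" "HOL-Library.Z2"
begin

text \<open>
  An edge is the set of its two ends, and a signed graph is a record extending the record of a
  graph. Notions that ignore signs are stated for the extensible record type, so that applying
  them to a signed graph applies them to its underlying graph.
\<close>

record 'a graph =
  verts :: "'a set"
  edges :: "'a set set"

record 'a signed_graph = "'a graph" +
  neg_edges :: "'a set set"

definition simple_graph :: "('a, 'b) graph_scheme \<Rightarrow> bool" where
  "simple_graph G \<longleftrightarrow>
     finite (verts G) \<and> (\<forall>e\<in>edges G. e \<subseteq> verts G \<and> card e = 2)"

definition signed_graph :: "'a signed_graph \<Rightarrow> bool" where
  "signed_graph G \<longleftrightarrow> simple_graph G \<and> neg_edges G \<subseteq> edges G"

definition bipartite :: "('a, 'b) graph_scheme \<Rightarrow> bool" where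
  "bipartite G \<longleftrightarrow>
     (\<exists>A B. A \<union> B = verts G \<and> A \<inter> B = {} \<and> (\<forall>e\<in>edges G. \<exists>a\<in>A. \<exists>b\<in>B. e = {a, b}))"

text \<open>
  A walk is given by its nonempty list of successive vertices. A closed walk repeats its first
  vertex at the end, so a walk of length \<open>n\<close> is a list of length \<open>n + 1\<close>.
\<close>

definition walk :: "('a, 'b) graph_scheme \<Rightarrow> 'a list \<Rightarrow> bool" where
  "walk G p \<longleftrightarrow> p \<noteq> [] \<and> set p \<subseteq> verts G \<and>
     (\<forall>i < length p - 1. {p ! i, p ! Suc i} \<in> edges G)"

definition walk_length :: "'a list \<Rightarrow> nat" where
  "walk_length p = length p - 1"

definition closed_walk :: "('a, 'b) graph_scheme \<Rightarrow> 'a list \<Rightarrow> bool" where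
  "closed_walk G p \<longleftrightarrow> walk G p \<and> hd p = last p"

definition cycle :: "('a, 'b) graph_scheme \<Rightarrow> 'a list \<Rightarrow> bool" where
  "cycle G p \<longleftrightarrow> closed_walk G p \<and> walk_length p \<ge> 3 \<and> distinct (tl p)"

definition edge_sign :: "'a signed_graph \<Rightarrow> 'a set \<Rightarrow> int" where
  "edge_sign G e = (if e \<in> neg_edges G then -1 else 1)"

definition walk_sign :: "'a signed_graph \<Rightarrow> 'a list \<Rightarrow> int" where
  "walk_sign G p = (\<Prod>i<walk_length p. edge_sign G {p ! i, p ! Suc i})"

definition balanced :: "'a signed_graph \<Rightarrow> 'a list \<Rightarrow> bool" where
  "balanced G p \<longleftrightarrow> walk_sign G p = 1"

text \<open>The infimum of the empty set of extended naturals is \<open>\<infinity>\<close>.\<close>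

definition unbalanced_girth :: "'a signed_graph \<Rightarrow> enat" where
  "unbalanced_girth G = Inf {enat (walk_length p) |p. cycle G p \<and> \<not> balanced G p}"

definition signed_hom :: "('a \<Rightarrow> 'b) \<Rightarrow> 'a signed_graph \<Rightarrow> 'b signed_graph \<Rightarrow> bool" where
  "signed_hom \<phi> G H \<longleftrightarrow>
     \<phi> ` verts G \<subseteq> verts H \<and>
     (\<forall>e\<in>edges G. \<phi> ` e \<in> edges H) \<and>
     (\<forall>p. closed_walk G p \<longrightarrow>
        closed_walk H (map \<phi> p) \<and> (balanced H (map \<phi> p) \<longleftrightarrow> balanced G p))"

definition connected_on :: "('a, 'b) graph_scheme \<Rightarrow> 'a set \<Rightarrow> bool" where
  "connected_on G S \<longleftrightarrow> S \<noteq> {} \<and>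
     (\<forall>u\<in>S. \<forall>v\<in>S. \<exists>p. walk G p \<and> set p \<subseteq> S \<and> hd p = u \<and> last p = v)"

text \<open>
  \<open>H\<close> is a minor of \<open>G\<close>: there are disjoint connected branch sets in \<open>G\<close>, one for each vertex
  of \<open>H\<close>, such that those of adjacent vertices are joined by an edge.
\<close>

definition has_minor :: "('a, 'b) graph_scheme \<Rightarrow> ('c, 'd) graph_scheme \<Rightarrow> bool" where
  "has_minor G H \<longleftrightarrow> (\<exists>B.
     (\<forall>x\<in>verts H. B x \<subseteq> verts G \<and> connected_on G (B x)) \<and>
     (\<forall>x\<in>verts H. \<forall>y\<in>verts H. x \<noteq> y \<longrightarrow> B x \<inter> B y = {}) \<and>
     (\<forall>x y. {x, y} \<in> edges H \<longrightarrow> (\<exists>u\<in>B x. \<exists>v\<in>B y. {u, v} \<in> edges G)))"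

definition complete_graph :: "nat \<Rightarrow> nat graph" where
  "complete_graph n = \<lparr>verts = {..<n}, edges = {e. e \<subseteq> {..<n} \<and> card e = 2}\<rparr>"

text \<open>
  Vectors of length \<open>d\<close> over the two-element field \<^typ>\<open>bit\<close> are functions on the natural
  numbers that vanish from \<open>d\<close> on, with coordinates indexed from \<open>0\<close>. Subtraction is pointwise.
\<close>

definition bit_vecs :: "nat \<Rightarrow> (nat \<Rightarrow> bit) set" where
  "bit_vecs d = {u. \<forall>i\<ge>d. u i = 0}"

definition unit_bvec :: "nat \<Rightarrow> nat \<Rightarrow> bit" where
  "unit_bvec i = (\<lambda>j. if j = i then 1 else 0)"

definition ones_bvec :: "nat \<Rightarrow> nat \<Rightarrow> bit" where
  "ones_bvec d = (\<lambda>j. if j < d then 1 else 0)"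

definition SPC :: "nat \<Rightarrow> (nat \<Rightarrow> bit) signed_graph" where
  "SPC d = \<lparr>
     verts = bit_vecs d,
     edges = {{u, v} |u v. u \<in> bit_vecs d \<and> v \<in> bit_vecs d \<and>
                u - v \<in> insert (ones_bvec d) (unit_bvec ` {..<d})},
     neg_edges = {{u, v} |u v. u \<in> bit_vecs d \<and> v \<in> bit_vecs d \<and> u - v = ones_bvec d}\<rparr>"

end

theory Submission
  imports Defs
begin

text \<open>
  The signed projective cube \<open>SPC (2k - 1)\<close> is the quotient of the hypercube of dimension \<open>2k\<close>
  by its antipodal map: a positive edge of \<open>G\<close> may be sent to a pair of points at distance \<open>1\<close>,
  and a negative edge to a pair at distance \<open>2k - 1\<close>, that is, to a point and the antipode of a
  neighbour. So it suffices to place the vertices of \<open>G\<close> in the hypercube such that the two ends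
  of each positive edge are at distance \<open>1\<close> and those of each negative edge at distance \<open>2k - 1\<close>
  (\<open>signed_hom_SPC_of_cube\<close>).

  Such a placement is found by prescribing a distance for every pair of vertices, adjacent or
  not. In the hypercube, if two points are at distance \<open>a\<close>, then a third point at distances \<open>b\<close>
  and \<open>c\<close> from them exists as soon as \<open>a + b + c\<close> is even, the triangle inequalities hold and \<open>a
  + b + c \<le> 4k\<close> (\<open>cube_extend_two\<close>). Hence if all triples of prescribed distances are of this
  kind, the vertices of a \<open>K\<^sub>4\<close>-minor-free graph can be placed one after another: some vertex
  has degree at most two, and in the case of two neighbours, contracting it into one of them
  leaves a smaller graph of the same class in which they are adjacent, so that they can be
  placed first, at the distance prescribed for them (\<open>cube_realization\<close>).

  The prescribed distance of \<open>u\<close> and \<open>v\<close> comes from the lengths \<open>P\<close> and \<open>N\<close> of a shortest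
  positive and a shortest negative walk between them. Under such a placement, a positive walk of
  length \<open>P\<close> bounds the distance of its ends from above by \<open>P\<close>, and a negative walk of length
  \<open>N\<close> bounds it from below by \<open>2k - N\<close>. The girth hypothesis says that this interval is not
  empty: the two walks form an unbalanced closed walk, which contains an unbalanced cycle, so
  \<open>2k - N \<le> P\<close>. The prescribed distance is the point of \<open>[2k - N, P]\<close> that is closest to the
  middle \<open>k\<close> of the cube, where \<open>k\<close> is replaced by \<open>k + 1\<close> if the bipartition of \<open>G\<close> asks for
  the other parity. The triangle inequalities for signed walks make all triples admissible
  (\<open>label_cube_triple\<close>).

  A vertex of degree at most two exists by Dirac's theorem that minimum degree three forces a
  \<open>K\<^sub>4\<close>-minor. This is proved by contractions alone, for graphs in which one root vertex is
  allowed any positive degree (\<open>K4_minor_if_degrees_ge_3_except_root\<close>).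
\<close>

section \<open>Connected sets and contraction\<close>

lemma walk_single [simp]: "walk G [x] \<longleftrightarrow> x \<in> verts G"
  by (simp add: walk_def)

lemma walk_Cons_Cons [simp]:
  "walk G (x # y # p) \<longleftrightarrow> x \<in> verts G \<and> {x, y} \<in> edges G \<and> walk G (y # p)"
  unfolding walk_def by (auto simp: All_less_Suc2)

lemma walk_append: "walk G (p @ x # q) \<longleftrightarrow> walk G (p @ [x]) \<and> walk G (x # q)"
proof (induction p)
  case Nil
  then show ?case by (cases q) auto
next
  case (Cons a p)
  then show ?case by (cases p) auto
qed

lemma walk_leaves_set:
  assumes "walk G p" "set p \<subseteq> S" "hd p \<in> A" "last p \<notin> A"
  shows "\<exists>a\<in>A. \<exists>b\<in>S - A. {a, b} \<in> edges G"
  using assms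
proof (induction p rule: induct_list012)
  case (3 x y p)
  then show ?case by (cases "y \<in> A") auto
qed (auto simp: walk_def)

text \<open>
  Cuts are easier to pull back along a contraction than walks, so connectedness is handled
  through them.
\<close>

lemma connected_on_iff_cut:
  assumes "S \<subseteq> verts G"
  shows "connected_on G S \<longleftrightarrow> S \<noteq> {} \<and>
    (\<forall>A. A \<subseteq> S \<and> A \<noteq> {} \<and> A \<noteq> S \<longrightarrow> (\<exists>a\<in>A. \<exists>b\<in>S - A. {a, b} \<in> edges G))"
    (is "_ \<longleftrightarrow> ?R")
proof
  assume c: "connected_on G S"
  show ?R
  proof (intro conjI allI impI)
    show "S \<noteq> {}" using c by (simp add: connected_on_def)
    fix A assume A: "A \<subseteq> S \<and> A \<noteq> {} \<and> A \<noteq> S"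
    then obtain u v where "u \<in> A" "v \<in> S" "v \<notin> A" by blast
    moreover from this c A obtain p where "walk G p" "set p \<subseteq> S" "hd p = u" "last p = v"
      unfolding connected_on_def by blast
    ultimately show "\<exists>a\<in>A. \<exists>b\<in>S - A. {a, b} \<in> edges G"
      using walk_leaves_set by metis
  qed
next
  assume R: ?R
  show "connected_on G S"
    unfolding connected_on_def
  proof (intro conjI ballI)
    show "S \<noteq> {}" using R by blast
    fix u v assume uv: "u \<in> S" "v \<in> S"
    define A where "A = {x \<in> S. \<exists>p. walk G p \<and> set p \<subseteq> S \<and> hd p = u \<and> last p = x}"
    have "walk G [u]" "set [u] \<subseteq> S" "hd [u] = u" "last [u] = u" using uv assms by auto
    then have "u \<in> A" unfolding A_def using uv by blast
    have "A = S"
    proof (rule ccontr)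
      assume "A \<noteq> S"
      moreover have "A \<subseteq> S" "A \<noteq> {}" using \<open>u \<in> A\<close> A_def by auto
      ultimately obtain a b where ab: "a \<in> A" "b \<in> S" "b \<notin> A" "{a, b} \<in> edges G"
        using R by blast
      then obtain p where p: "walk G p" "set p \<subseteq> S" "hd p = u" "last p = a" "p \<noteq> []"
        unfolding A_def walk_def by blast
      then obtain q where "p = q @ [a]" by (metis append_butlast_last_id)
      then have "walk G (p @ [b])" using p ab assms walk_append[of G q a "[b]"] by auto
      moreover have "set (p @ [b]) \<subseteq> S" "hd (p @ [b]) = u" "last (p @ [b]) = b"
        using p ab by auto
      ultimately have "b \<in> A" unfolding A_def using ab by blast
      then show False using ab by blast
    qed
    then show "\<exists>p. walk G p \<and> set p \<subseteq> S \<and> hd p = u \<and> last p = v"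
      using uv A_def by blast
  qed
qed

lemma connected_on_singleton: "x \<in> verts G \<Longrightarrow> connected_on G {x}"
  by (subst connected_on_iff_cut) auto

lemma connected_on_insert:
  assumes "connected_on G S" "S \<subseteq> verts G" "a \<in> S" "{a, b} \<in> edges G" "b \<in> verts G"
  shows "connected_on G (insert b S)"
proof -
  have sub: "insert b S \<subseteq> verts G" using assms by auto
  have cut: "\<exists>x\<in>A. \<exists>y\<in>S - A. {x, y} \<in> edges G" if "A \<subseteq> S" "A \<noteq> {}" "A \<noteq> S" for A
    using assms(1) that unfolding connected_on_iff_cut[OF assms(2)] by blast
  have "\<exists>x\<in>A. \<exists>y\<in>insert b S - A. {x, y} \<in> edges G"
    if A: "A \<subseteq> insert b S" "A \<noteq> {}" "A \<noteq> insert b S" for A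
  proof (cases "a \<in> A \<longleftrightarrow> b \<in> A")
    case False
    then show ?thesis using assms(3,4) by (metis Diff_iff insertCI insert_commute)
  next
    case True
    then have "A \<inter> S \<subseteq> S" "A \<inter> S \<noteq> {}" "A \<inter> S \<noteq> S"
      using A assms(3) by blast+
    then show ?thesis using cut[of "A \<inter> S"] by blast
  qed
  then show ?thesis unfolding connected_on_iff_cut[OF sub] by blast
qed

lemma has_minor_mono:
  fixes G :: "('a, 'b) graph_scheme" and G' :: "('a, 'c) graph_scheme"
    and H :: "('d, 'e) graph_scheme"
  assumes "has_minor G' H" "verts G' \<subseteq> verts G" "edges G' \<subseteq> edges G"
  shows "has_minor G H"
proof -
  have "walk G p" if "walk G' p" for p
    using that assms(2,3) unfolding walk_def by blast
  then have "connected_on G S" if "connected_on G' S" for S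
    using that unfolding connected_on_def by blast
  then have "B x \<subseteq> verts G \<and> connected_on G (B x)"
    if "B x \<subseteq> verts G' \<and> connected_on G' (B x)" for B :: "'d \<Rightarrow> 'a set" and x
    using that assms(2) by blast
  moreover have "\<exists>u\<in>X. \<exists>v\<in>Y. {u, v} \<in> edges G"
    if "\<exists>u\<in>X. \<exists>v\<in>Y. {u, v} \<in> edges G'" for X Y
    using that assms(3) by blast
  ultimately have "has_minor G H" if "\<forall>x\<in>verts H. B x \<subseteq> verts G' \<and> connected_on G' (B x)"
    "\<forall>x\<in>verts H. \<forall>y\<in>verts H. x \<noteq> y \<longrightarrow> B x \<inter> B y = {}"
    "\<forall>x y. {x, y} \<in> edges H \<longrightarrow> (\<exists>u\<in>B x. \<exists>v\<in>B y. {u, v} \<in> edges G')" for B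
    unfolding has_minor_def using that by (intro exI[of _ B]) simp
  then show ?thesis using assms(1) unfolding has_minor_def[of G'] by blast
qed

definition collapse :: "'a set \<Rightarrow> 'a \<Rightarrow> 'a \<Rightarrow> 'a" where
  "collapse S r x = (if x \<in> S then r else x)"

definition contract :: "('a, 'b) graph_scheme \<Rightarrow> 'a set \<Rightarrow> 'a \<Rightarrow> 'a graph" where
  "contract G S r = \<lparr>verts = insert r (verts G - S),
     edges = {{collapse S r a, collapse S r b} |a b.
                {a, b} \<in> edges G \<and> collapse S r a \<noteq> collapse S r b}\<rparr>"

lemma simple_graph_edgeD:
  assumes "simple_graph G" "{x, y} \<in> edges G"
  shows "x \<in> verts G" "y \<in> verts G" "x \<noteq> y"
proof -
  have "{x, y} \<subseteq> verts G" "card {x, y} = 2" using assms unfolding simple_graph_def by blast+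
  then show "x \<in> verts G" "y \<in> verts G" "x \<noteq> y" by auto
qed

lemma contract_edge_lift:
  assumes "{x, y} \<in> edges (contract G S r)"
  obtains a b where "{a, b} \<in> edges G" "collapse S r a = x" "collapse S r b = y"
proof -
  from assms obtain a b where "{x, y} = {collapse S r a, collapse S r b}" "{a, b} \<in> edges G"
    unfolding contract_def by auto
  then show thesis using that by (metis doubleton_eq_iff insert_commute)
qed

lemma simple_graph_contract:
  assumes "simple_graph G" "r \<in> S"
  shows "simple_graph (contract G S r)"
  unfolding simple_graph_def
proof (intro conjI ballI)
  show "finite (verts (contract G S r))"
    using assms by (simp add: simple_graph_def contract_def)
  fix e assume "e \<in> edges (contract G S r)"
  then obtain a b where ab: "e = {collapse S r a, collapse S r b}" "{a, b} \<in> edges G"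
      "collapse S r a \<noteq> collapse S r b"
    unfolding contract_def by auto
  then show "e \<subseteq> verts (contract G S r)" "card e = 2"
    using simple_graph_edgeD[OF assms(1) ab(2)] by (auto simp: contract_def collapse_def)
qed

text \<open>
  A vertex set that splits the contracted set is left by an edge of that set; any other vertex
  set is a union of fibres, and is left by a lift of an edge of the contraction.
\<close>

lemma connected_on_collapse_vimage:
  assumes G: "simple_graph G" and S: "S \<subseteq> verts G" "connected_on G S" "r \<in> S"
    and B: "B \<subseteq> verts (contract G S r)" "connected_on (contract G S r) B"
  shows "connected_on G {x \<in> verts G. collapse S r x \<in> B}" (is "connected_on G ?B'")
proof -
  let ?c = "collapse S r"
  have ne: "?B' \<noteq> {}"
  proof -
    obtain x where "x \<in> B" using B(2) by (auto simp: connected_on_def)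
    then have "x \<in> ?B'" using B(1) S by (auto simp: contract_def collapse_def)
    then show ?thesis by blast
  qed
  have "\<exists>a\<in>A. \<exists>b\<in>?B' - A. {a, b} \<in> edges G" if A: "A \<subseteq> ?B'" "A \<noteq> {}" "A \<noteq> ?B'" for A
  proof (cases "A \<inter> S \<noteq> {} \<and> \<not> S \<subseteq> A")
    case True
    then have "A \<inter> S \<subseteq> S" "A \<inter> S \<noteq> {}" "A \<inter> S \<noteq> S" by blast+
    then have "\<exists>a\<in>A \<inter> S. \<exists>b\<in>S - A \<inter> S. {a, b} \<in> edges G"
      using S(2) unfolding connected_on_iff_cut[OF S(1)] by blast
    then obtain a b where ab: "a \<in> A \<inter> S" "b \<in> S - A" "{a, b} \<in> edges G" by blast
    then have "b \<in> ?B'" using A(1) S(1) by (auto simp: collapse_def)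
    then show ?thesis using ab by blast
  next
    case False
    \<comment> \<open>\<open>A\<close> contains \<open>S\<close> or misses it, so \<open>A\<close> is a union of fibres.\<close>
    then have fib: "x \<in> A \<longleftrightarrow> y \<in> A" if "?c x = ?c y" for x y
      using that S(3) by (auto simp: collapse_def split: if_splits)
    have img: "?c ` A \<subseteq> B" "?c ` A \<noteq> {}" using A by auto
    obtain z where z: "z \<in> ?B'" "z \<notin> A" using A by blast
    have "?c z \<notin> ?c ` A" using z fib by blast
    then have "?c ` A \<noteq> B" using z by blast
    then have "\<exists>x\<in>?c ` A. \<exists>y\<in>B - ?c ` A. {x, y} \<in> edges (contract G S r)"
      using img B(2)[unfolded connected_on_iff_cut[OF B(1)]] by presburger
    then obtain x y where
      xy: "x \<in> ?c ` A" "y \<in> B" "y \<notin> ?c ` A" "{x, y} \<in> edges (contract G S r)"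
      by blast
    from xy(4) obtain a b where ab: "{a, b} \<in> edges G" "?c a = x" "?c b = y"
      by (rule contract_edge_lift)
    have "a \<in> A" using xy(1) ab fib by blast
    moreover have "b \<notin> A" "b \<in> ?B'" using xy ab simple_graph_edgeD[OF G ab(1)] by auto
    ultimately show ?thesis using ab by blast
  qed
  moreover have "?B' \<subseteq> verts G" by blast
  ultimately show ?thesis using ne by (simp only: connected_on_iff_cut) simp
qed

lemma has_minor_contract:
  assumes G: "simple_graph G" and S: "S \<subseteq> verts G" "connected_on G S" "r \<in> S"
    and minor: "has_minor (contract G S r) H"
    and H: "\<And>x y. {x, y} \<in> edges H \<Longrightarrow> x \<in> verts H \<and> y \<in> verts H"
  shows "has_minor G H"
proof -
  from minor obtain B where B:
    "\<And>x. x \<in> verts H \<Longrightarrow> B x \<subseteq> verts (contract G S r) \<and> connected_on (contract G S r) (B x)"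
    "\<And>x y. x \<in> verts H \<Longrightarrow> y \<in> verts H \<Longrightarrow> x \<noteq> y \<Longrightarrow> B x \<inter> B y = {}"
    "\<And>x y. {x, y} \<in> edges H \<Longrightarrow> \<exists>u\<in>B x. \<exists>v\<in>B y. {u, v} \<in> edges (contract G S r)"
    unfolding has_minor_def by metis
  define B' where "B' x = {v \<in> verts G. collapse S r v \<in> B x}" for x
  have "B' x \<subseteq> verts G \<and> connected_on G (B' x)" if "x \<in> verts H" for x
    using connected_on_collapse_vimage[OF G S] B(1)[OF that] unfolding B'_def by blast
  moreover have "B' x \<inter> B' y = {}" if "x \<in> verts H" "y \<in> verts H" "x \<noteq> y" for x y
    using B(2)[OF that] unfolding B'_def by blast
  moreover have "\<exists>u\<in>B' x. \<exists>v\<in>B' y. {u, v} \<in> edges G" if xy: "{x, y} \<in> edges H" for x y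
  proof -
    obtain u v where uv: "u \<in> B x" "v \<in> B y" "{u, v} \<in> edges (contract G S r)"
      using B(3)[OF xy] by blast
    from uv(3) obtain a b where "{a, b} \<in> edges G" "collapse S r a = u" "collapse S r b = v"
      by (rule contract_edge_lift)
    then show ?thesis using uv simple_graph_edgeD[OF G] unfolding B'_def by blast
  qed
  ultimately show ?thesis unfolding has_minor_def by metis
qed

lemma has_minor_complete_contract:
  assumes "simple_graph G" "S \<subseteq> verts G" "connected_on G S" "r \<in> S"
    and "has_minor (contract G S r) (complete_graph n)"
  shows "has_minor G (complete_graph n)"
  using has_minor_contract[OF assms] by (auto simp: complete_graph_def)

section \<open>A graph of minimum degree three has a \<open>K\<^sub>4\<close>-minor\<close>

definition nbrs :: "('a, 'b) graph_scheme \<Rightarrow> 'a \<Rightarrow> 'a set" where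
  "nbrs G x = {y. {x, y} \<in> edges G}"

lemma nbrs_sym: "y \<in> nbrs G x \<longleftrightarrow> x \<in> nbrs G y"
  by (simp add: nbrs_def insert_commute)

lemma nbrs_subset: "simple_graph G \<Longrightarrow> nbrs G x \<subseteq> verts G - {x}"
  using simple_graph_edgeD[of G] unfolding nbrs_def by blast

lemma finite_nbrs: "simple_graph G \<Longrightarrow> finite (nbrs G x)"
  using nbrs_subset[of G x] by (auto simp: simple_graph_def intro: finite_subset)

lemma connected_on_edge:
  assumes "simple_graph G" "{a, b} \<in> edges G"
  shows "connected_on G {a, b}"
  using connected_on_insert[OF connected_on_singleton[of a G], of a b]
    simple_graph_edgeD[OF assms] assms by (simp add: insert_commute)

lemma edge_contract_iff:
  "{x, y} \<in> edges (contract G S r) \<longleftrightarrow>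
    x \<noteq> y \<and> (\<exists>a b. {a, b} \<in> edges G \<and> collapse S r a = x \<and> collapse S r b = y)"
proof
  assume L: "{x, y} \<in> edges (contract G S r)"
  then have "x \<noteq> y" unfolding contract_def by (auto simp: doubleton_eq_iff)
  then show "x \<noteq> y \<and> (\<exists>a b. {a, b} \<in> edges G \<and> collapse S r a = x \<and> collapse S r b = y)"
    using contract_edge_lift[OF L] by metis
qed (auto simp: contract_def)

lemma nbrs_contract_outside:
  assumes "x \<notin> S" "r \<in> S"
  shows "nbrs (contract G S r) x =
    (if nbrs G x \<inter> S = {} then nbrs G x else insert r (nbrs G x - S)) - {x}"
  using assms by (auto simp: nbrs_def edge_contract_iff collapse_def split: if_splits)

lemma nbrs_contract_root:
  assumes "r \<in> S"
  shows "nbrs (contract G S r) r = (\<Union>s\<in>S. nbrs G s) - S"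
  using assms by (auto simp: nbrs_def edge_contract_iff collapse_def split: if_splits)

text \<open>
  A vertex outside the contracted set loses degree only if two of its neighbours are identified.
\<close>

lemma card_nbrs_contract_ge:
  assumes G: "simple_graph G" and x: "x \<notin> S" "r \<in> S" and one: "card (nbrs G x \<inter> S) \<le> 1"
  shows "card (nbrs G x) \<le> card (nbrs (contract G S r) x)"
proof -
  have xx: "x \<notin> nbrs G x" using nbrs_subset[OF G] by blast
  show ?thesis
  proof (cases "nbrs G x \<inter> S = {}")
    case True
    then show ?thesis using xx x by (simp add: nbrs_contract_outside)
  next
    case False
    have fin: "finite (nbrs G x)" using finite_nbrs[OF G] .
    have "nbrs (contract G S r) x = insert r (nbrs G x - S)"
      using False xx x by (auto simp: nbrs_contract_outside)
    moreover have "card (nbrs G x) = card (nbrs G x \<inter> S) + card (nbrs G x - S)"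
      using card_Int_Diff[OF fin] .
    ultimately show ?thesis using fin x one by simp
  qed
qed

lemma has_K4_minorI:
  assumes "A \<subseteq> verts G" "B \<subseteq> verts G" "C \<subseteq> verts G" "D \<subseteq> verts G"
    and "connected_on G A" "connected_on G B" "connected_on G C" "connected_on G D"
    and "A \<inter> B = {}" "A \<inter> C = {}" "A \<inter> D = {}" "B \<inter> C = {}" "B \<inter> D = {}" "C \<inter> D = {}"
    and "\<exists>u\<in>A. \<exists>v\<in>B. {u, v} \<in> edges G" "\<exists>u\<in>A. \<exists>v\<in>C. {u, v} \<in> edges G"
      "\<exists>u\<in>A. \<exists>v\<in>D. {u, v} \<in> edges G" "\<exists>u\<in>B. \<exists>v\<in>C. {u, v} \<in> edges G"
      "\<exists>u\<in>B. \<exists>v\<in>D. {u, v} \<in> edges G" "\<exists>u\<in>C. \<exists>v\<in>D. {u, v} \<in> edges G"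
  shows "has_minor G (complete_graph 4)"
proof -
  define f where "f = (!) [A, B, C, D]"
  have f: "f 0 = A" "f 1 = B" "f 2 = C" "f 3 = D" by (simp_all add: f_def)
  have four: "x = 0 \<or> x = 1 \<or> x = 2 \<or> x = 3" if "x < 4" for x :: nat using that by auto
  have sym: "\<exists>u\<in>X. \<exists>v\<in>Y. {u, v} \<in> edges G" if "\<exists>u\<in>Y. \<exists>v\<in>X. {u, v} \<in> edges G" for X Y
    using that by (metis insert_commute)
  have "f x \<subseteq> verts G \<and> connected_on G (f x)" if "x < 4" for x
    using four[OF that] assms f by auto
  moreover have "f x \<inter> f y = {}" if "x < 4" "y < 4" "x \<noteq> y" for x y
    using four[OF that(1)] four[OF that(2)] that(3) assms f by (elim disjE) (simp_all add: Int_commute)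
  moreover have "\<exists>u\<in>f x. \<exists>v\<in>f y. {u, v} \<in> edges G" if "x < 4" "y < 4" "x \<noteq> y" for x y
    using four[OF that(1)] four[OF that(2)] that(3) assms(15-20) assms(15-20)[THEN sym] f
    by (elim disjE) simp_all
  ultimately show ?thesis
    unfolding has_minor_def complete_graph_def by (intro exI[of _ f]) (auto simp: card_2_iff doubleton_eq_iff)
qed

lemma card_3_two_known:
  assumes "card X = 3" "a \<in> X" "b \<in> X" "a \<noteq> b"
  obtains c where "X = {a, b, c}" "c \<noteq> a" "c \<noteq> b"
proof -
  have "card (X - {a, b}) = 1" using assms by (simp add: card_Diff_subset)
  then obtain c where c: "X - {a, b} = {c}" by (auto simp: card_1_singleton_iff)
  then have "X = {a, b, c}" "c \<noteq> a" "c \<noteq> b" using assms by auto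
  then show thesis by (rule that)
qed

text \<open>
  The root lets the induction go through, since a vertex merged into the root need only keep
  some neighbour. Consider a smallest counterexample.

  Contracting an edge from the root \<open>r\<close> to \<open>u\<close> must lower the degree of some vertex below three,
  so every neighbour \<open>u\<close> of \<open>r\<close> has a common neighbour with \<open>r\<close> of degree exactly three.
  Applying this twice gives adjacent neighbours \<open>w\<close> and \<open>w'\<close> of \<open>r\<close>, both of degree three; let
  \<open>y\<close> and \<open>z\<close> be their third neighbours. If \<open>y \<noteq> z\<close>, contracting the edge \<open>ww'\<close> gives a vertex
  of degree three and lowers the degree of \<open>r\<close> only. If \<open>y = z\<close>, then \<open>r, w, w', y\<close> is a \<open>K\<^sub>4\<close>
  without the edge \<open>ry\<close>; it is completed to a \<open>K\<^sub>4\<close>-minor if \<open>r\<close> and \<open>y\<close> are adjacent or have a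
  further common neighbour, and otherwise contracting all four vertices into \<open>r\<close> identifies no
  two neighbours of a remaining vertex.
\<close>

lemma K4_minor_if_degrees_ge_3_except_root:
  fixes G :: "'a graph"
  assumes "simple_graph G" "nbrs G r \<noteq> {}"
    and "\<And>x. x \<in> verts G \<Longrightarrow> x \<noteq> r \<Longrightarrow> 3 \<le> card (nbrs G x)"
  shows "has_minor G (complete_graph 4)"
  using assms
proof (induction "card (verts G)" arbitrary: G r rule: less_induct)
  case less
  note G = less.prems(1) and r_ne = less.prems(2) and deg = less.prems(3)
  have finV: "finite (verts G)" using G by (simp add: simple_graph_def)
  have nb: "y \<in> verts G" "y \<noteq> x" if "y \<in> nbrs G x" for x y
    using nbrs_subset[OF G] that by blast+
  have rV: "r \<in> verts G" using r_ne nb nbrs_sym by fastforce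
  \<comment> \<open>The induction hypothesis for a contraction that keeps \<open>r\<close> as its root.\<close>
  have step: "has_minor G (complete_graph 4)"
    if S: "S \<subseteq> verts G" "connected_on G S" "q \<in> S" "card S \<ge> 2"
      and root: "nbrs (contract G S q) r \<noteq> {}"
      and out: "\<And>x. x \<in> verts G - S \<Longrightarrow> x \<noteq> r \<Longrightarrow> 3 \<le> card (nbrs (contract G S q) x)"
      and q: "q = r \<or> 3 \<le> card (nbrs (contract G S q) q)" for S q
  proof -
    have finS: "finite S" using S finV finite_subset by blast
    have "verts (contract G S q) = insert q (verts G - S)" by (simp add: contract_def)
    then have "card (verts (contract G S q)) = Suc (card (verts G) - card S)"
      using finV finS S by (simp add: card_Diff_subset)
    moreover have "card S \<le> card (verts G)" using S finV card_mono by blast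
    ultimately have "card (verts (contract G S q)) < card (verts G)" using S by linarith
    moreover have "3 \<le> card (nbrs (contract G S q) x)"
      if "x \<in> verts (contract G S q)" "x \<noteq> r" for x
      using that out q by (auto simp: contract_def)
    ultimately have "has_minor (contract G S q) (complete_graph 4)"
      using less.hyps simple_graph_contract[OF G S(3)] root by blast
    then show ?thesis using has_minor_complete_contract[OF G S(1-3)] by blast
  qed
  show ?case
  proof (rule ccontr)
    assume no: "\<not> ?case"
    have triangle: "\<exists>w. w \<in> nbrs G r \<and> w \<in> nbrs G u \<and> card (nbrs G w) = 3"
      if u: "u \<in> nbrs G r" for u
    proof (rule ccontr)
      assume none: "\<not> ?thesis"
      have ur: "u \<noteq> r" "u \<in> verts G" using nb[OF u] by auto
      have "has_minor G (complete_graph 4)"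
      proof (rule step[of "{r, u}" r])
        show "{r, u} \<subseteq> verts G" "r \<in> {r, u}" "2 \<le> card {r, u}" using ur rV by auto
        show "connected_on G {r, u}"
          using connected_on_edge[OF G] u by (simp add: nbrs_def)
        have "\<not> nbrs G u \<subseteq> {r}"
          using deg[of u] ur card_mono[of "{r}" "nbrs G u"] by fastforce
        then obtain z where "z \<in> nbrs G u" "z \<noteq> r" by blast
        moreover have "z \<noteq> u" using nb calculation by blast
        ultimately show "nbrs (contract G {r, u} r) r \<noteq> {}"
          by (auto simp: nbrs_contract_root)
      next
        fix x assume x: "x \<in> verts G - {r, u}" "x \<noteq> r"
        show "3 \<le> card (nbrs (contract G {r, u} r) x)"
        proof (cases "r \<in> nbrs G x \<and> u \<in> nbrs G x")
          case True
          then have "x \<in> nbrs G r" "x \<in> nbrs G u" using nbrs_sym by fast+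
          then have "card (nbrs G x) \<noteq> 3" using none by blast
          then have "4 \<le> card (nbrs G x)" using deg[of x] x by force
          moreover have "nbrs (contract G {r, u} r) x = nbrs G x - {u}"
            using True x nb(2)[of _ x] ur by (auto simp: nbrs_contract_outside)
          ultimately show ?thesis using True finite_nbrs[OF G] by simp
        next
          case False
          then have "nbrs G x \<inter> {r, u} \<subseteq> {r} \<or> nbrs G x \<inter> {r, u} \<subseteq> {u}" by blast
          then have "card (nbrs G x \<inter> {r, u}) \<le> 1"
            using card_mono[of "{r}" "nbrs G x \<inter> {r, u}"] card_mono[of "{u}" "nbrs G x \<inter> {r, u}"]
            by auto
          then show ?thesis using card_nbrs_contract_ge[OF G, of x "{r, u}" r] x deg[of x] by force
        qed
      qed auto
      then show False using no by blast
    qed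
    obtain w where w: "w \<in> nbrs G r" "card (nbrs G w) = 3" using r_ne triangle by blast
    obtain w' where w': "w' \<in> nbrs G r" "w' \<in> nbrs G w" "card (nbrs G w') = 3"
      using triangle[OF w(1)] by blast
    have dist: "w \<noteq> r" "w' \<noteq> r" "w \<noteq> w'" using nb w w' by blast+
    have V: "w \<in> verts G" "w' \<in> verts G" using nb w w' by blast+
    obtain y where y: "nbrs G w = {r, w', y}" "y \<noteq> r" "y \<noteq> w'"
      using card_3_two_known[OF w(2), of r w'] w(1) w'(2) dist nbrs_sym by metis
    obtain z where z: "nbrs G w' = {r, w, z}" "z \<noteq> r" "z \<noteq> w"
      using card_3_two_known[OF w'(3), of r w] w'(1,2) dist nbrs_sym by metis
    have yz: "y \<noteq> w" "z \<noteq> w'" "y \<in> verts G" using nb y(1) z(1) by blast+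
    have adj: "w \<in> nbrs G x \<longleftrightarrow> x \<in> {r, w', y}" "w' \<in> nbrs G x \<longleftrightarrow> x \<in> {r, w, z}" for x
      using y(1) z(1) nbrs_sym by metis+
    have E: "{r, w} \<in> edges G" "{r, w'} \<in> edges G" "{w, w'} \<in> edges G" "{w, y} \<in> edges G"
      using w w' y z by (auto simp: nbrs_def)
    show False
    proof (cases "y = z")
      case False
      have "has_minor G (complete_graph 4)"
      proof (rule step[of "{w, w'}" w])
        show "{w, w'} \<subseteq> verts G" "w \<in> {w, w'}" "2 \<le> card {w, w'}" using V dist by auto
        show "connected_on G {w, w'}" using connected_on_edge[OF G E(3)] .
        show "nbrs (contract G {w, w'} w) r \<noteq> {}"
          using dist adj by (auto simp: nbrs_contract_outside)
        have "nbrs (contract G {w, w'} w) w = {r, y, z}"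
          using dist y z yz by (auto simp: nbrs_contract_root)
        then show "w = r \<or> 3 \<le> card (nbrs (contract G {w, w'} w) w)" using y z False by simp
      next
        fix x assume x: "x \<in> verts G - {w, w'}" "x \<noteq> r"
        have "nbrs G x \<inter> {w, w'} \<subseteq> {w} \<or> nbrs G x \<inter> {w, w'} \<subseteq> {w'}"
          using adj x False by auto
        then have "card (nbrs G x \<inter> {w, w'}) \<le> 1"
          using card_mono[of "{w}" "nbrs G x \<inter> {w, w'}"] card_mono[of "{w'}" "nbrs G x \<inter> {w, w'}"]
          by auto
        then show "3 \<le> card (nbrs (contract G {w, w'} w) x)"
          using card_nbrs_contract_ge[OF G, of x "{w, w'}" w] x deg[of x] by force
      qed
      then show False using no by blast
    next
      case True
      have E': "{w', y} \<in> edges G" using z True by (auto simp: nbrs_def)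
      have K4: "has_minor G (complete_graph 4)"
        if A: "A \<subseteq> verts G" "connected_on G A" "r \<in> A" "A \<inter> {w, w', y} = {}"
          "\<exists>u\<in>A. {u, y} \<in> edges G" for A
        by (rule has_K4_minorI[of A G "{w}" "{w'}" "{y}"])
          (use A E E' V yz y dist in \<open>auto intro: connected_on_singleton\<close>)
      have ry: "r \<notin> nbrs G y"
      proof
        assume "r \<in> nbrs G y"
        then have "{r, y} \<in> edges G" by (simp add: nbrs_def insert_commute)
        then show False
          using K4[of "{r}"] no rV connected_on_singleton[OF rV] dist y by auto
      qed
      have common: "t \<in> {w, w'}" if t: "t \<in> nbrs G r" "t \<in> nbrs G y" for t
      proof (rule ccontr)
        assume "t \<notin> {w, w'}"
        moreover have "t \<noteq> y" "t \<in> verts G" using nb t by blast+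
        moreover have "{r, t} \<in> edges G" "{t, y} \<in> edges G"
          using t by (auto simp: nbrs_def insert_commute)
        ultimately show False
          using K4[of "{r, t}"] no rV connected_on_edge[OF G] dist y by auto
      qed
      let ?S = "{r, w, w', y}"
      have "has_minor G (complete_graph 4)"
      proof (rule step[of ?S r])
        show S: "?S \<subseteq> verts G" using rV V yz by auto
        show "r \<in> ?S" by simp
        show "2 \<le> card ?S" using dist y yz by simp
        have "connected_on G {r, w}" using connected_on_edge[OF G E(1)] .
        then have "connected_on G {w', r, w}"
          using connected_on_insert[of G "{r, w}" w w'] E V rV by auto
        then have "connected_on G {y, w', r, w}"
          using connected_on_insert[of G "{w', r, w}" w y] E V rV yz by auto
        then show "connected_on G ?S" by (simp add: insert_commute)
        have "\<not> nbrs G y \<subseteq> {w, w'}"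
        proof
          assume "nbrs G y \<subseteq> {w, w'}"
          then have "card (nbrs G y) \<le> 2" using card_mono[of "{w, w'}" "nbrs G y"] dist by simp
          then show False using deg[of y] yz y by simp
        qed
        then obtain t where "t \<in> nbrs G y" "t \<notin> {w, w'}" by blast
        moreover have "t \<noteq> r" "t \<noteq> y" using calculation ry nb by blast+
        ultimately show "nbrs (contract G ?S r) r \<noteq> {}" by (auto simp: nbrs_contract_root)
      next
        fix x assume x: "x \<in> verts G - ?S" "x \<noteq> r"
        have "w \<notin> nbrs G x" "w' \<notin> nbrs G x" using adj x True by auto
        moreover have "\<not> (r \<in> nbrs G x \<and> y \<in> nbrs G x)"
          using common[of x] x nbrs_sym by fast
        ultimately have "nbrs G x \<inter> ?S \<subseteq> {r} \<or> nbrs G x \<inter> ?S \<subseteq> {y}" by blast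
        then have "card (nbrs G x \<inter> ?S) \<le> 1"
          using card_mono[of "{r}" "nbrs G x \<inter> ?S"] card_mono[of "{y}" "nbrs G x \<inter> ?S"]
          by auto
        then show "3 \<le> card (nbrs (contract G ?S r) x)"
          using card_nbrs_contract_ge[OF G, of x ?S r] x deg[of x] by force
      qed auto
      then show False using no by blast
    qed
  qed
qed

lemma exists_degree_le_2:
  fixes G :: "'a graph"
  assumes "simple_graph G" "verts G \<noteq> {}" "\<not> has_minor G (complete_graph 4)"
  shows "\<exists>v\<in>verts G. card (nbrs G v) \<le> 2"
proof (rule ccontr)
  assume "\<not> ?thesis"
  then have deg: "3 \<le> card (nbrs G v)" if "v \<in> verts G" for v
    using that by force
  obtain r where "r \<in> verts G" using assms by blast
  then have "nbrs G r \<noteq> {}" using deg[of r] by auto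
  then show False using K4_minor_if_degrees_ge_3_except_root[OF assms(1)] deg assms(3) by blast
qed

section \<open>Distances in the hypercube\<close>

text \<open>
  These are exactly the distances between three points of the hypercube of dimension \<open>n\<close>: each
  coordinate separates none or two of the three pairs. Points are encoded as subsets of
  \<open>{..<n}\<close>, so that their distance is the size of the symmetric difference.
\<close>

definition cube_triple :: "nat \<Rightarrow> nat \<Rightarrow> nat \<Rightarrow> nat \<Rightarrow> bool" where
  "cube_triple n a b c \<longleftrightarrow>
     even (a + b + c) \<and> a \<le> b + c \<and> b \<le> a + c \<and> c \<le> a + b \<and> a + b + c \<le> 2 * n"

lemma cube_extend_one:
  assumes "P \<subseteq> {..<n}" "b \<le> n"
  shows "\<exists>R\<subseteq>{..<n}. card (sym_diff P R) = b"
proof -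
  obtain I where I: "I \<subseteq> {..<n}" "card I = b"
    using obtain_subset_with_card_n[of b "{..<n}"] assms by auto
  have "sym_diff P (sym_diff P I) = I" by blast
  moreover have "sym_diff P I \<subseteq> {..<n}" using I assms by blast
  ultimately show ?thesis using I by metis
qed

text \<open>
  Starting from \<open>P\<close>, flip \<open>i\<close> coordinates in which \<open>P\<close> and \<open>Q\<close> differ and \<open>j\<close> in which they
  agree. The distances of the result from \<open>P\<close> and \<open>Q\<close> are \<open>i + j\<close> and \<open>a - i + j\<close>, where \<open>a\<close> is
  the distance of \<open>P\<close> and \<open>Q\<close>.
\<close>

lemma cube_extend_two:
  assumes P: "P \<subseteq> {..<n}" and Q: "Q \<subseteq> {..<n}" and t: "cube_triple n (card (sym_diff P Q)) b c"
  shows "\<exists>R\<subseteq>{..<n}. card (sym_diff P R) = b \<and> card (sym_diff Q R) = c"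
proof -
  let ?D = "sym_diff P Q"
  let ?a = "card ?D"
  have D: "?D \<subseteq> {..<n}" using P Q by blast
  then have finD: "finite ?D" using finite_subset by blast
  obtain m where m: "?a + b + c = 2 * m" using t unfolding cube_triple_def by blast
  define i j where "i = m - c" and "j = m - ?a"
  have arith: "i + j = b" "?a - i + j = c" "i \<le> ?a" "j \<le> n - ?a"
    using t m unfolding cube_triple_def i_def j_def by linarith+
  obtain I where I: "I \<subseteq> ?D" "card I = i"
    using obtain_subset_with_card_n[OF arith(3)] by metis
  have "card ({..<n} - ?D) = n - ?a" using D finD by (simp add: card_Diff_subset)
  then obtain J where J: "J \<subseteq> {..<n} - ?D" "card J = j"
    using obtain_subset_with_card_n arith(4) by metis
  have fin: "finite I" "finite J" using I J finD finite_subset by (blast intro: finite_subset)+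
  define R where "R = sym_diff P (I \<union> J)"
  have "R \<subseteq> {..<n}" using P I J D unfolding R_def by blast
  moreover have "sym_diff P R = I \<union> J" unfolding R_def by blast
  then have "card (sym_diff P R) = b"
    using I J fin arith by (subst \<open>sym_diff P R = _\<close>, subst card_Un_disjoint) auto
  moreover have "sym_diff Q R = (?D - I) \<union> J" using I J unfolding R_def by blast
  then have "card (sym_diff Q R) = c"
    using I J fin finD arith
    by (subst \<open>sym_diff Q R = _\<close>, subst card_Un_disjoint) (auto simp: card_Diff_subset)
  ultimately show ?thesis by blast
qed

text \<open>
  The distances \<open>d\<close> are prescribed for all pairs of vertices, so the hypotheses pass to every
  contraction of an edge, although the contraction has edges that \<open>G\<close> does not have.
\<close>

lemma cube_realization:
  fixes G :: "'a graph"
  assumes "simple_graph G" "\<not> has_minor G (complete_graph 4)"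
    and "\<And>u v. u \<in> verts G \<Longrightarrow> v \<in> verts G \<Longrightarrow> d u v = d v u \<and> d u v \<le> n"
    and "\<And>u v w. u \<in> verts G \<Longrightarrow> v \<in> verts G \<Longrightarrow> w \<in> verts G \<Longrightarrow>
           u \<noteq> v \<Longrightarrow> u \<noteq> w \<Longrightarrow> v \<noteq> w \<Longrightarrow> cube_triple n (d u v) (d u w) (d v w)"
  shows "\<exists>x. (\<forall>v\<in>verts G. x v \<subseteq> {..<n}) \<and>
    (\<forall>u v. {u, v} \<in> edges G \<longrightarrow> card (sym_diff (x u) (x v)) = d u v)"
  using assms
proof (induction "card (verts G)" arbitrary: G rule: less_induct)
  case less
  note G = less.prems(1) and no = less.prems(2) and d = less.prems(3) and tri = less.prems(4)
  have finV: "finite (verts G)" using G by (simp add: simple_graph_def)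
  show ?case
  proof (cases "verts G = {}")
    case True
    then show ?thesis using simple_graph_edgeD[OF G] by blast
  next
    case False
    then obtain v where v: "v \<in> verts G" "card (nbrs G v) \<le> 2"
      using exists_degree_le_2[OF G _ no] by blast
    have nbV: "p \<in> verts G" "p \<noteq> v" if "p \<in> nbrs G v" for p
      using nbrs_subset[OF G] that by blast+
    \<comment> \<open>\<open>H\<close> is \<open>G\<close> without \<open>v\<close>, with the two neighbours of \<open>v\<close> joined; \<open>v\<close> is placed last.\<close>
    have extend: ?thesis
      if H: "simple_graph H" "\<not> has_minor H (complete_graph 4)" "verts H = verts G - {v}"
        and keep: "\<And>a b. {a, b} \<in> edges G \<Longrightarrow> a \<noteq> v \<Longrightarrow> b \<noteq> v \<Longrightarrow> {a, b} \<in> edges H"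
        and new: "\<And>p q. nbrs G v = {p, q} \<Longrightarrow> p \<noteq> q \<Longrightarrow> {p, q} \<in> edges H" for H :: "'a graph"
    proof -
      have "card (verts H) < card (verts G)"
        using H v finV card_Diff1_less by metis
      from less.hyps[OF this H(1,2)] have "\<exists>x. (\<forall>u\<in>verts H. x u \<subseteq> {..<n}) \<and>
          (\<forall>a b. {a, b} \<in> edges H \<longrightarrow> card (sym_diff (x a) (x b)) = d a b)"
        using d tri unfolding H(3) by blast
      then obtain x where x: "\<And>u. u \<in> verts G - {v} \<Longrightarrow> x u \<subseteq> {..<n}"
          "\<And>a b. {a, b} \<in> edges H \<Longrightarrow> card (sym_diff (x a) (x b)) = d a b"
        unfolding H(3) by blast
      have "\<exists>R\<subseteq>{..<n}. \<forall>p\<in>nbrs G v. card (sym_diff (x p) R) = d p v"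
      proof -
        consider "nbrs G v = {}" | p where "nbrs G v = {p}"
          | p q where "nbrs G v = {p, q}" "p \<noteq> q"
        proof -
          have "card (nbrs G v) = 0 \<or> card (nbrs G v) = 1 \<or> card (nbrs G v) = 2"
            using v(2) by linarith
          then show thesis
            using finite_nbrs[OF G, of v] that by (auto simp: card_1_singleton_iff card_2_iff)
        qed
        then show ?thesis
        proof cases
          case 1
          then show ?thesis by blast
        next
          case 2
          then show ?thesis
            using cube_extend_one[of "x p" n "d p v"] x(1) nbV d v by simp
        next
          case (3 p q)
          then have pq: "p \<in> verts G" "q \<in> verts G" "p \<noteq> v" "q \<noteq> v" using nbV by auto
          have "cube_triple n (card (sym_diff (x p) (x q))) (d p v) (d q v)"
            using x(2)[OF new[OF 3]] tri[of p q v] pq 3 v by simp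
          then show ?thesis
            using cube_extend_two[of "x p" n "x q" "d p v" "d q v"] x(1) pq 3 by simp
        qed
      qed
      then obtain R where R: "R \<subseteq> {..<n}" "\<And>p. p \<in> nbrs G v \<Longrightarrow> card (sym_diff (x p) R) = d p v"
        by blast
      let ?x = "x(v := R)"
      have "card (sym_diff (?x a) (?x b)) = d a b" if ab: "{a, b} \<in> edges G" for a b
      proof -
        note abV = simple_graph_edgeD[OF G ab]
        consider "a \<noteq> v" "b \<noteq> v" | "b = v" "a \<noteq> v" | "a = v" "b \<noteq> v" using abV by blast
        then show ?thesis
        proof cases
          case 1
          then show ?thesis using x(2) keep ab by simp
        next
          case 2
          then show ?thesis using R(2)[of a] ab by (simp add: nbrs_def insert_commute)
        next
          case 3
          then show ?thesis using R(2)[of b] ab d abV by (simp add: nbrs_def Un_commute)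
        qed
      qed
      moreover have "\<forall>u\<in>verts G. ?x u \<subseteq> {..<n}" using R x by simp
      ultimately show ?thesis by blast
    qed
    show ?thesis
    proof (cases "nbrs G v = {}")
      case True
      let ?H = "\<lparr>verts = verts G - {v}, edges = edges G\<rparr> :: 'a graph"
      have "v \<notin> e" if e: "e \<in> edges G" for e
      proof
        assume "v \<in> e"
        moreover have "card e = 2" using G e by (simp add: simple_graph_def)
        ultimately obtain y where "e = {v, y}" by (auto simp: card_2_iff)
        then show False using True e by (auto simp: nbrs_def)
      qed
      then have "simple_graph ?H" using G by (auto simp: simple_graph_def)
      moreover have "\<not> has_minor ?H (complete_graph 4)"
        using has_minor_mono[of ?H _ G] no by auto
      ultimately show ?thesis using extend[of ?H] True by simp
    next
      case False
      then obtain p where p: "p \<in> nbrs G v" by blast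
      let ?H = "contract G {p, v} p"
      have pv: "{p, v} \<in> edges G" using p by (simp add: nbrs_def insert_commute)
      show ?thesis
      proof (rule extend[of ?H])
        show "simple_graph ?H" using simple_graph_contract[OF G] by blast
        show "\<not> has_minor ?H (complete_graph 4)"
          using has_minor_complete_contract[OF G _ connected_on_edge[OF G pv]] no nbV p v
          by auto
        show "verts ?H = verts G - {v}" using nbV p by (auto simp: contract_def)
      next
        fix a b assume ab: "{a, b} \<in> edges G" "a \<noteq> v" "b \<noteq> v"
        have "collapse {p, v} p a = a" "collapse {p, v} p b = b"
          using ab by (auto simp: collapse_def)
        then show "{a, b} \<in> edges ?H"
          using ab(1) simple_graph_edgeD(3)[OF G ab(1)] unfolding edge_contract_iff by blast
      next
        fix a b assume ab: "nbrs G v = {a, b}" "a \<noteq> b"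
        have "q \<in> nbrs ?H p" if "q \<in> nbrs G v" "q \<noteq> p" for q
          using that nbV by (auto simp: nbrs_contract_root)
        then have "{p, q} \<in> edges ?H" if "q \<in> nbrs G v" "q \<noteq> p" for q
          using that unfolding nbrs_def[of ?H] by blast
        then have "{p, a} \<in> edges ?H \<or> a = p" "{p, b} \<in> edges ?H \<or> b = p" "p = a \<or> p = b"
          using ab(1) p by blast+
        then show "{a, b} \<in> edges ?H" using ab(2) by (auto simp: insert_commute)
      qed
    qed
  qed
qed

section \<open>Signs of walks\<close>

lemma walk_sign_single [simp]: "walk_sign G [x] = 1"
  by (simp add: walk_sign_def walk_length_def)

lemma walk_sign_Cons_Cons [simp]:
  "walk_sign G (x # y # p) = edge_sign G {x, y} * walk_sign G (y # p)"
  by (simp add: walk_sign_def walk_length_def prod.lessThan_Suc_shift del: prod.lessThan_Suc)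

lemma walk_sign_append:
  "walk_sign G (p @ x # q) = walk_sign G (p @ [x]) * walk_sign G (x # q)"
proof (induction p)
  case (Cons a p)
  then show ?case by (cases p) auto
qed simp

lemma walk_sign_rev: "p \<noteq> [] \<Longrightarrow> walk_sign G (rev p) = walk_sign G p"
proof (induction p rule: induct_list012)
  case (3 x y p)
  then show ?case
    using walk_sign_append[of G "rev p" y "[x]"] by (simp add: insert_commute)
qed auto

lemma walk_rev: "walk G (rev p) \<longleftrightarrow> walk G p"
proof (induction p rule: induct_list012)
  case (3 x y p)
  have "{x, y} \<in> edges G \<and> y \<in> verts G \<and> x \<in> verts G \<and> walk G (rev p @ [y]) \<longleftrightarrow>
      x \<in> verts G \<and> {x, y} \<in> edges G \<and> walk G (y # p)"
    using 3 by (auto simp: walk_def)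
  then show ?case
    using walk_append[of G "rev p" y "[x]"] by (auto simp: insert_commute)
qed (auto simp: walk_def)

text \<open>
  A closed walk that repeats a vertex other than by returning to its start splits there into two
  shorter closed walks, and its sign is the product of their signs. A closed walk of length at
  most two is balanced.
\<close>

lemma unbalanced_closed_walk_contains_cycle:
  assumes G: "simple_graph G" and "closed_walk G p" "\<not> balanced G p"
  shows "\<exists>c. cycle G c \<and> \<not> balanced G c \<and> walk_length c \<le> walk_length p"
  using assms(2,3)
proof (induction "length p" arbitrary: p rule: less_induct)
  case less
  note cw = less.prems(1) and ub = less.prems(2)
  then have p: "walk G p" "hd p = last p" "p \<noteq> []" by (auto simp: closed_walk_def walk_def)
  show ?case
  proof (cases "distinct (tl p)")
    case True
    have "walk_length p \<ge> 3"
    proof (rule ccontr)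
      assume "\<not> ?thesis"
      then have "length p \<le> 3" by (simp add: walk_length_def)
      then consider a where "p = [a]" | a b where "p = [a, b]" | a b c where "p = [a, b, c]"
        using p(3) by (auto simp: le_Suc_eq length_Suc_conv numeral_3_eq_3)
      then show False
        using p ub simple_graph_edgeD[OF G]
        by cases (auto simp: balanced_def insert_commute edge_sign_def split: if_splits)
    qed
    then show ?thesis using True cw ub by (auto simp: cycle_def)
  next
    case False
    then obtain as x bs cs where "tl p = as @ [x] @ bs @ [x] @ cs"
      using not_distinct_decomp by metis
    then obtain a where pe: "p = (a # as) @ x # bs @ x # cs"
      using p(3) by (cases p) auto
    let ?q = "x # bs @ [x]" and ?r = "(a # as) @ x # cs"
    have w: "walk G ?q" "walk G ?r"
      using p(1) walk_append[of G "a # as" x "bs @ x # cs"] walk_append[of G "x # bs" x cs]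
        walk_append[of G "a # as" x cs]
      unfolding pe by simp_all
    have s: "walk_sign G p = walk_sign G ?q * walk_sign G ?r"
      using walk_sign_append[of G "a # as" x "bs @ x # cs"] walk_sign_append[of G "x # bs" x cs]
        walk_sign_append[of G "a # as" x cs]
      unfolding pe by simp
    have "closed_walk G ?q" "closed_walk G ?r" using w p(2) by (simp_all add: closed_walk_def pe)
    moreover have "\<not> balanced G ?q \<or> \<not> balanced G ?r" using s ub by (auto simp: balanced_def)
    moreover have "length ?q < length p" "length ?r < length p" by (simp_all add: pe)
    ultimately obtain q where "closed_walk G q" "\<not> balanced G q" "length q < length p" by blast
    moreover from this obtain c where "cycle G c" "\<not> balanced G c" "walk_length c \<le> walk_length q"
      using less.hyps by blast
    ultimately show ?thesis by (auto simp: walk_length_def)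
  qed
qed

definition linked :: "'a signed_graph \<Rightarrow> int \<Rightarrow> nat \<Rightarrow> 'a \<Rightarrow> 'a \<Rightarrow> bool" where
  "linked G s n u v \<longleftrightarrow>
     (\<exists>p. walk G p \<and> hd p = u \<and> last p = v \<and> walk_length p = n \<and> walk_sign G p = s)"

lemma linked_sym:
  assumes "linked G s n u v"
  shows "linked G s n v u"
proof -
  obtain p where p: "walk G p" "hd p = u" "last p = v" "walk_length p = n" "walk_sign G p = s"
    using assms by (auto simp: linked_def)
  then have "p \<noteq> []" by (auto simp: walk_def)
  then show ?thesis using p
    unfolding linked_def by (intro exI[of _ "rev p"])
      (simp add: walk_rev walk_sign_rev hd_rev last_rev walk_length_def)
qed

lemma linked_trans:
  assumes "linked G s n u v" "linked G t m v w"
  shows "linked G (s * t) (n + m) u w"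
proof -
  obtain p where p: "walk G p" "hd p = u" "last p = v" "walk_length p = n" "walk_sign G p = s"
    using assms by (auto simp: linked_def)
  obtain q where q: "walk G q" "hd q = v" "last q = w" "walk_length q = m" "walk_sign G q = t"
    using assms by (auto simp: linked_def)
  have "p \<noteq> []" "q \<noteq> []" using p q by (auto simp: walk_def)
  then obtain p' q' where pq: "p = p' @ [v]" "q = v # q'"
    using p q by (metis append_butlast_last_id list.collapse)
  then show ?thesis
    using p q unfolding linked_def
    by (intro exI[of _ "p' @ v # q'"])
      (auto simp: walk_append[of G p' v q'] walk_sign_append[of G p' v q'] walk_length_def
        hd_append)
qed

lemma linked_edge:
  assumes "simple_graph G" "{u, v} \<in> edges G"
  shows "linked G (edge_sign G {u, v}) 1 u v"
  unfolding linked_def using simple_graph_edgeD[OF assms] assms(2)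
  by (intro exI[of _ "[u, v]"]) (simp add: walk_length_def)

lemma linked_0: "linked G s 0 u v \<Longrightarrow> u = v"
  unfolding linked_def walk_def walk_length_def
  by (auto simp: length_Suc_conv le_Suc_eq hd_conv_nth last_conv_nth)

lemma unbalanced_girth_le_opposite_walks:
  assumes G: "simple_graph G" and "linked G 1 m u v" "linked G (-1) n u v"
  shows "unbalanced_girth G \<le> enat (m + n)"
proof -
  have "linked G (-1) (m + n) u u" using linked_trans[OF assms(2) linked_sym[OF assms(3)]] by simp
  then obtain p where "walk G p" "hd p = u" "last p = u" "walk_length p = m + n" "walk_sign G p = -1"
    unfolding linked_def by blast
  then have p: "closed_walk G p" "\<not> balanced G p" "walk_length p = m + n"
    by (simp_all add: closed_walk_def balanced_def)
  then obtain c where "cycle G c" "\<not> balanced G c" "walk_length c \<le> m + n"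
    using unbalanced_closed_walk_contains_cycle[OF G] by metis
  then have "unbalanced_girth G \<le> enat (walk_length c)"
    unfolding unbalanced_girth_def by (intro Inf_lower) blast
  also have "\<dots> \<le> enat (m + n)" using \<open>walk_length c \<le> m + n\<close> by simp
  finally show ?thesis .
qed

lemma bipartite_linked_parity:
  assumes "\<And>x y. {x, y} \<in> edges G \<Longrightarrow> x \<in> A \<longleftrightarrow> y \<notin> A" and "linked G s n u v"
  shows "even n \<longleftrightarrow> (u \<in> A \<longleftrightarrow> v \<in> A)"
proof -
  have "even (walk_length p) \<longleftrightarrow> (hd p \<in> A \<longleftrightarrow> last p \<in> A)" if "walk G p" for p
    using that
  proof (induction p rule: induct_list012)
    case (3 x y p)
    then show ?case using assms(1)[of x y] by (auto simp: walk_length_def)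
  qed (auto simp: walk_def walk_length_def)
  then show ?thesis using assms(2) by (auto simp: linked_def)
qed

section \<open>Labels from the lengths of signed walks\<close>

text \<open>
  For \<open>2k - N \<le> P\<close>, the number \<open>max (2k - N) (min P m)\<close> is the point of \<open>[2k - N, P]\<close> closest to
  \<open>m\<close>. The indices \<open>1\<close>, \<open>2\<close>, \<open>3\<close> stand for the three pairs of a triple of vertices, and \<open>P\<close> and
  \<open>N\<close> for the lengths of positive and negative walks; the inequalities between them are those
  that follow from concatenating two walks.
\<close>

lemma median_triangle:
  fixes k :: nat
  assumes "P1 \<le> P2 + P3" "N2 \<le> N1 + P3" "N3 \<le> N1 + P2" "1 \<le> P2" "1 \<le> P3" "1 \<le> k"
    and "m1 \<in> {k, Suc k}" "m2 \<in> {k, Suc k}" "m3 \<in> {k, Suc k}"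
  shows "max (2 * k - N1) (min P1 m1) \<le>
    max (2 * k - N2) (min P2 m2) + max (2 * k - N3) (min P3 m3)"
proof -
  let ?a2 = "max (2 * k - N2) (min P2 m2)" and ?a3 = "max (2 * k - N3) (min P3 m3)"
  have pos: "1 \<le> ?a2" "1 \<le> ?a3" using assms by auto
  have "2 * k - N1 \<le> ?a2 + ?a3"
  proof (cases "P2 \<le> m2 \<or> P3 \<le> m3")
    case True
    then show ?thesis using assms(2,3) by linarith
  next
    case False
    then have "m2 \<le> ?a2" "m3 \<le> ?a3" by simp_all
    moreover have "k \<le> m2" "k \<le> m3" using assms by auto
    ultimately show ?thesis by linarith
  qed
  moreover have "min P1 m1 \<le> ?a2 + ?a3"
  proof (cases "P2 \<le> m2 \<and> P3 \<le> m3")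
    case True
    then show ?thesis using assms(1) by linarith
  next
    case False
    then have "m2 \<le> ?a2 \<or> m3 \<le> ?a3" by auto
    moreover have "min P1 m1 \<le> Suc k" "k \<le> m2" "k \<le> m3" using assms by auto
    ultimately show ?thesis using pos by linarith
  qed
  ultimately show ?thesis by simp
qed

text \<open>
  Each of the three medians is either \<open>2k - N\<close> or at most both \<open>P\<close> and \<open>m\<close>. If one of them is
  \<open>2k - N\<close>, then the middle values \<open>m\<close> bound the other two; if two are, then a concatenation of
  walks bounds the third; if all are, then \<open>2k \<le> P1 + N1 \<le> N1 + N2 + N3\<close>. The parities exclude
  the extreme cases: three middle values \<open>3\<close> for \<open>k = 2\<close>, and two middle values \<open>k + 1\<close> next to
  a negative walk of length \<open>1\<close>.
\<close>

lemma median_perimeter: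
  fixes k :: nat
  assumes k: "2 \<le> k"
    and P: "P1 \<le> N2 + N3" "P2 \<le> N1 + N3" "P3 \<le> N1 + N2" and N: "1 \<le> N1" "1 \<le> N2" "1 \<le> N3"
    and girth: "2 * k \<le> P1 + N1"
    and m: "m1 \<in> {k, Suc k}" "m2 \<in> {k, Suc k}" "m3 \<in> {k, Suc k}"
    and par: "even (m1 + m2 + m3)" "even (m1 + N1)" "even (m2 + N2)" "even (m3 + N3)"
  shows "max (2 * k - N1) (min P1 m1) + max (2 * k - N2) (min P2 m2)
    + max (2 * k - N3) (min P3 m3) \<le> 4 * k"
proof -
  have two: "x + y \<le> 2 * k + N" if "x \<in> {k, Suc k}" "y \<in> {k, Suc k}" "1 \<le> N" "even (x + y + N)"
    for x y N :: nat
  proof (cases "x = Suc k \<and> y = Suc k")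
    case True
    then have "N \<noteq> 1" using that(4) by auto
    then show ?thesis using True that(3) by linarith
  next
    case False
    then show ?thesis using that by auto
  qed
  have m2: "m2 + m3 \<le> 2 * k + N1" "m1 + m3 \<le> 2 * k + N2" "m1 + m2 \<le> 2 * k + N3"
    using two[of m2 m3 N1] two[of m1 m3 N2] two[of m1 m2 N3] m N par by auto
  have m3: "m1 + m2 + m3 \<le> 4 * k"
  proof (cases "k = 2")
    case True
    then have "m1 + m2 + m3 \<noteq> 9" using par(1) by presburger
    then show ?thesis using m True by auto
  next
    case False
    then show ?thesis using m k by auto
  qed
  have med: "max (2 * k - n) (min p m) + n = 2 * k \<or>
      max (2 * k - n) (min p m) \<le> p \<and> max (2 * k - n) (min p m) \<le> m" for n p m :: nat
    by linarith
  show ?thesis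
    using med[of N1 P1 m1] med[of N2 P2 m2] med[of N3 P3 m3] m2 m3 P girth by linarith
qed

lemma median_parity:
  fixes k :: nat
  assumes "even N \<longleftrightarrow> q" "even P \<longleftrightarrow> q" "even m \<longleftrightarrow> q" "1 \<le> P" "1 \<le> m"
  shows "even (max (2 * k - N) (min P m)) \<longleftrightarrow> q"
proof (cases "N \<le> 2 * k")
  case True
  then have "even (2 * k - N) \<longleftrightarrow> q" using assms(1) by simp
  then show ?thesis using assms by (simp add: max_def min_def)
next
  case False
  then show ?thesis using assms by (simp add: max_def min_def)
qed

locale bipartite_of_unbalanced_girth =
  fixes G :: "'a signed_graph" and A :: "'a set" and k :: nat
  assumes simple: "simple_graph G"
    and crossing: "\<And>x y. {x, y} \<in> edges G \<Longrightarrow> x \<in> A \<longleftrightarrow> y \<notin> A"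
    and girth: "enat (2 * k) \<le> unbalanced_girth G"
    and k_ge_2: "2 \<le> k"
begin

definition same_side :: "'a \<Rightarrow> 'a \<Rightarrow> bool" where
  "same_side u v \<longleftrightarrow> (u \<in> A \<longleftrightarrow> v \<in> A)"

text \<open>
  The length of a shortest walk of sign \<open>s\<close>, cut off at \<open>2k\<close> or \<open>2k + 1\<close>, whichever has the
  parity of a walk from \<open>u\<close> to \<open>v\<close>. The cut-off provides a value if there is no such walk, and
  it is large enough to keep the triangle inequalities between distinct vertices.
\<close>

definition walk_dist :: "int \<Rightarrow> 'a \<Rightarrow> 'a \<Rightarrow> nat" where
  "walk_dist s u v = (LEAST n. linked G s n u v \<or> 2 * k \<le> n \<and> (even n \<longleftrightarrow> same_side u v))"

definition middle :: "'a \<Rightarrow> 'a \<Rightarrow> nat" where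
  "middle u v = (if even k \<longleftrightarrow> same_side u v then k else Suc k)"

definition label :: "'a \<Rightarrow> 'a \<Rightarrow> nat" where
  "label u v = max (2 * k - walk_dist (-1) u v) (min (walk_dist 1 u v) (middle u v))"

lemma linked_parity: "linked G s n u v \<Longrightarrow> even n \<longleftrightarrow> same_side u v"
  unfolding same_side_def by (rule bipartite_linked_parity[OF crossing])

lemma walk_dist_le_linked: "linked G s n u v \<Longrightarrow> walk_dist s u v \<le> n"
  unfolding walk_dist_def by (rule Least_le) blast

lemma walk_dist_le_cap: "walk_dist s u v \<le> Suc (2 * k)"
proof -
  have "walk_dist s u v \<le> (if same_side u v then 2 * k else Suc (2 * k))"
    unfolding walk_dist_def by (rule Least_le) simp
  then show ?thesis by (simp split: if_splits)
qed

lemma walk_dist_cases: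
  "linked G s (walk_dist s u v) u v \<or>
   2 * k \<le> walk_dist s u v \<and> (even (walk_dist s u v) \<longleftrightarrow> same_side u v)"
  unfolding walk_dist_def
  by (rule LeastI[of _ "if same_side u v then 2 * k else Suc (2 * k)"]) simp

lemma even_walk_dist: "even (walk_dist s u v) \<longleftrightarrow> same_side u v"
  using walk_dist_cases linked_parity by blast

lemma walk_dist_sym: "walk_dist s u v = walk_dist s v u"
proof -
  have "linked G s n u v \<longleftrightarrow> linked G s n v u" for n using linked_sym by metis
  moreover have "same_side u v \<longleftrightarrow> same_side v u" unfolding same_side_def by blast
  ultimately show ?thesis unfolding walk_dist_def by simp
qed

lemma walk_dist_pos: "u \<noteq> v \<Longrightarrow> 1 \<le> walk_dist s u v"
  using walk_dist_cases[of s u v] linked_0[of G s u v] k_ge_2 by (cases "walk_dist s u v") auto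

lemma walk_dist_triangle:
  assumes "u \<noteq> v" "v \<noteq> w"
  shows "walk_dist (s * t) u w \<le> walk_dist s u v + walk_dist t v w"
proof (cases "linked G s (walk_dist s u v) u v \<and> linked G t (walk_dist t v w) v w")
  case True
  then show ?thesis using linked_trans walk_dist_le_linked by metis
next
  case False
  then have "2 * k \<le> walk_dist s u v \<or> 2 * k \<le> walk_dist t v w" using walk_dist_cases by blast
  then show ?thesis
    using walk_dist_pos[OF assms(1), of s] walk_dist_pos[OF assms(2), of t]
      walk_dist_le_cap[of "s * t" u w] by linarith
qed

lemma walk_dist_opposite: "2 * k \<le> walk_dist 1 u v + walk_dist (-1) u v"
proof (cases "linked G 1 (walk_dist 1 u v) u v \<and> linked G (-1) (walk_dist (-1) u v) u v")
  case True
  then have "unbalanced_girth G \<le> enat (walk_dist 1 u v + walk_dist (-1) u v)"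
    using unbalanced_girth_le_opposite_walks[OF simple] by blast
  then have "enat (2 * k) \<le> enat (walk_dist 1 u v + walk_dist (-1) u v)"
    using girth order_trans by blast
  then show ?thesis by simp
next
  case False
  then have "2 * k \<le> walk_dist 1 u v \<or> 2 * k \<le> walk_dist (-1) u v"
    using walk_dist_cases by blast
  then show ?thesis by linarith
qed

lemma middle_cases: "middle u v \<in> {k, Suc k}"
  by (simp add: middle_def)

lemma even_middle: "even (middle u v) \<longleftrightarrow> same_side u v"
  by (simp add: middle_def)

lemma middle_sym: "middle u v = middle v u"
  by (auto simp: middle_def same_side_def)

lemma label_sym: "label u v = label v u"
  unfolding label_def using walk_dist_sym[of _ u v] middle_sym[of u v] by simp

lemma label_le: "label u v \<le> 2 * k"
  using middle_cases[of u v] k_ge_2 by (auto simp: label_def)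

lemma even_label:
  assumes "u \<noteq> v"
  shows "even (label u v) \<longleftrightarrow> same_side u v"
proof -
  have "1 \<le> middle u v" using middle_cases[of u v] k_ge_2 by auto
  then show ?thesis
    unfolding label_def using median_parity even_walk_dist even_middle walk_dist_pos[OF assms]
    by metis
qed

lemma label_triangle:
  assumes "u \<noteq> v" "v \<noteq> w" "u \<noteq> w"
  shows "label u w \<le> label u v + label v w"
  unfolding label_def
proof (rule median_triangle)
  show "walk_dist 1 u w \<le> walk_dist 1 u v + walk_dist 1 v w"
    using walk_dist_triangle[of u v w 1 1] assms by simp
  show "walk_dist (-1) u v \<le> walk_dist (-1) u w + walk_dist 1 v w"
    using walk_dist_triangle[of u w v "-1" 1] assms walk_dist_sym[of 1 v w] by simp
  show "walk_dist (-1) v w \<le> walk_dist (-1) u w + walk_dist 1 u v"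
    using walk_dist_triangle[of v u w 1 "-1"] assms walk_dist_sym[of 1 u v] by simp
  show "1 \<le> walk_dist 1 u v" "1 \<le> walk_dist 1 v w" using walk_dist_pos assms by auto
  show "1 \<le> k" using k_ge_2 by simp
qed (rule middle_cases)+

lemma label_cube_triple:
  assumes "u \<noteq> v" "u \<noteq> w" "v \<noteq> w"
  shows "cube_triple (2 * k) (label u v) (label u w) (label v w)"
proof -
  have side: "same_side u v \<longleftrightarrow> (same_side u w \<longleftrightarrow> same_side v w)" unfolding same_side_def by blast
  have "even (label u v + label u w + label v w)"
    using even_label assms side by auto
  moreover have "label u v \<le> label u w + label v w" "label u w \<le> label u v + label v w"
      "label v w \<le> label u v + label u w"
    using label_triangle[of u w v] label_triangle[of u v w] label_triangle[of v u w] assms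
      label_sym[of w v] label_sym[of v u] by auto
  moreover have "label u v + label u w + label v w \<le> 4 * k"
    unfolding label_def
  proof (rule median_perimeter)
    show "2 \<le> k" by (rule k_ge_2)
    show "walk_dist 1 u v \<le> walk_dist (-1) u w + walk_dist (-1) v w"
      using walk_dist_triangle[of u w v "-1" "-1"] assms walk_dist_sym[of "-1" v w] by simp
    show "walk_dist 1 u w \<le> walk_dist (-1) u v + walk_dist (-1) v w"
      using walk_dist_triangle[of u v w "-1" "-1"] assms by simp
    show "walk_dist 1 v w \<le> walk_dist (-1) u v + walk_dist (-1) u w"
      using walk_dist_triangle[of v u w "-1" "-1"] assms walk_dist_sym[of "-1" u v] by simp
    show "1 \<le> walk_dist (-1) u v" "1 \<le> walk_dist (-1) u w" "1 \<le> walk_dist (-1) v w"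
      using walk_dist_pos assms by auto
    show "2 * k \<le> walk_dist 1 u v + walk_dist (-1) u v" by (rule walk_dist_opposite)
    show "even (middle u v + middle u w + middle v w)" using even_middle side by auto
    show "even (middle u v + walk_dist (-1) u v)" "even (middle u w + walk_dist (-1) u w)"
      "even (middle v w + walk_dist (-1) v w)" using even_middle even_walk_dist by simp_all
  qed (rule middle_cases)+
  ultimately show ?thesis unfolding cube_triple_def by simp
qed

lemma label_edge:
  assumes "{u, v} \<in> edges G"
  shows "label u v = (if {u, v} \<in> neg_edges G then 2 * k - 1 else 1)"
proof -
  have "u \<noteq> v" using simple_graph_edgeD[OF simple assms] by blast
  then have pos: "1 \<le> walk_dist s u v" for s using walk_dist_pos by blast
  have m: "k \<le> middle u v" "middle u v \<le> Suc k" using middle_cases[of u v] by auto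
  have "walk_dist (edge_sign G {u, v}) u v \<le> 1"
    using walk_dist_le_linked[OF linked_edge[OF simple assms]] .
  then have one: "walk_dist (edge_sign G {u, v}) u v = 1" using pos le_antisym by blast
  show ?thesis
  proof (cases "{u, v} \<in> neg_edges G")
    case True
    then show ?thesis using one m k_ge_2 by (simp add: label_def edge_sign_def)
  next
    case False
    then show ?thesis
      using one m k_ge_2 walk_dist_opposite[of u v] by (simp add: label_def edge_sign_def)
  qed
qed

end

section \<open>From the hypercube to the signed projective cube\<close>

text \<open>
  Coordinates on the quotient of the hypercube of dimension \<open>d + 1\<close> by its antipodal map: the
  coordinate \<open>d\<close> is cleared by adding the all-ones vector if necessary, so that a flip of the
  coordinate \<open>d\<close> becomes the addition of \<open>ones_bvec d\<close>.
\<close>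

definition fold_antipodes :: "nat \<Rightarrow> nat set \<Rightarrow> nat \<Rightarrow> bit" where
  "fold_antipodes d S = (\<lambda>i. if i < d then of_bool (i \<in> S) + of_bool (d \<in> S) else 0)"

lemma fold_antipodes_in: "fold_antipodes d S \<in> bit_vecs d"
  by (simp add: fold_antipodes_def bit_vecs_def)

lemma fold_antipodes_diff:
  "fold_antipodes d S - fold_antipodes d T = fold_antipodes d (sym_diff S T)"
  by (auto simp: fold_antipodes_def fun_eq_iff of_bool_def)

lemma fold_antipodes_direction:
  assumes "D = {i} \<or> D = {..<Suc d} - {i}" "i < Suc d"
  shows "fold_antipodes d D = (if i = d then ones_bvec d else unit_bvec i)"
  using assms by (auto simp: fold_antipodes_def fun_eq_iff ones_bvec_def unit_bvec_def)

lemma unit_bvec_neq_ones_bvec: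
  assumes "2 \<le> d" "i < d"
  shows "unit_bvec i \<noteq> ones_bvec d"
proof
  assume eq: "unit_bvec i = ones_bvec d"
  obtain j where "j < d" "j \<noteq> i" using assms that[of 0] that[of 1] by fastforce
  then show False using fun_cong[OF eq, of j] by (simp add: unit_bvec_def ones_bvec_def)
qed

lemma neg_edges_SPC_iff:
  "{u, v} \<in> neg_edges (SPC d) \<longleftrightarrow> u \<in> bit_vecs d \<and> v \<in> bit_vecs d \<and> u - v = ones_bvec d"
proof -
  have "a - b = b - a" for a b :: bit by (cases a; cases b) simp_all
  then have "u - v = v - u" for u v :: "nat \<Rightarrow> bit" by (simp add: fun_eq_iff)
  then show ?thesis unfolding SPC_def by (auto simp: doubleton_eq_iff)
qed

text \<open>
  If the signs of the edges agree up to switching at the vertices with \<open>t = -1\<close>, then the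
  factors \<open>t\<close> at the inner vertices of a walk cancel; on a closed walk all of them do.
\<close>

lemma walk_sign_map_switching:
  fixes t :: "'a \<Rightarrow> int"
  assumes "\<And>a b. {a, b} \<in> edges G \<Longrightarrow>
      edge_sign H {\<phi> a, \<phi> b} = edge_sign G {a, b} * (t a * t b)"
    and "\<And>a. t a * t a = 1" and "walk G p"
  shows "walk_sign H (map \<phi> p) = walk_sign G p * (t (hd p) * t (last p))"
  using assms(3)
proof (induction p rule: induct_list012)
  case (3 x y p)
  then have "walk_sign H (map \<phi> (x # y # p)) =
      edge_sign G {x, y} * walk_sign G (y # p) * (t x * (t y * t y) * t (last (y # p)))"
    using assms(1)[of x y] by (simp add: algebra_simps)
  then show ?case using assms(2)[of y] by simp
qed (auto simp: walk_def assms(2))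

text \<open>
  The ends of a positive edge differ in exactly one coordinate \<open>i\<close>, and those of a negative edge
  agree in exactly one coordinate \<open>i\<close>. Either way the image in \<open>SPC d\<close> has the direction of the
  \<open>i\<close>-th unit vector if \<open>i < d\<close>, and is a negative edge if \<open>i = d\<close>. The resulting signature is
  that of \<open>G\<close>, switched at the vertices \<open>v\<close> with \<open>d \<in> x v\<close>.
\<close>

lemma signed_hom_SPC_of_cube:
  fixes G :: "'a signed_graph"
  assumes d: "2 \<le> d" and x: "\<And>v. v \<in> verts G \<Longrightarrow> x v \<subseteq> {..<Suc d}" and G: "simple_graph G"
    and dist: "\<And>u v. {u, v} \<in> edges G \<Longrightarrow>
      card (sym_diff (x u) (x v)) = (if {u, v} \<in> neg_edges G then d else 1)"
  shows "signed_hom (\<lambda>v. fold_antipodes d (x v)) G (SPC d)"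
proof -
  let ?\<phi> = "\<lambda>v. fold_antipodes d (x v)"
  define t :: "'a \<Rightarrow> int" where "t v = (if d \<in> x v then -1 else 1)" for v
  have edge: "{?\<phi> u, ?\<phi> v} \<in> edges (SPC d) \<and>
      edge_sign (SPC d) {?\<phi> u, ?\<phi> v} = edge_sign G {u, v} * (t u * t v)"
    if uv: "{u, v} \<in> edges G" for u v
  proof -
    let ?D = "sym_diff (x u) (x v)"
    have D: "?D \<subseteq> {..<Suc d}" using x simple_graph_edgeD[OF G uv] by blast
    have "\<exists>i<Suc d. ?D = (if {u, v} \<in> neg_edges G then {..<Suc d} - {i} else {i})"
    proof (cases "{u, v} \<in> neg_edges G")
      case True
      have "card ({..<Suc d} - ?D) = card {..<Suc d} - card ?D"
        by (rule card_Diff_subset[OF finite_subset[OF D finite_lessThan] D])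
      also have "\<dots> = 1" using dist[OF uv] True by simp
      finally have "card ({..<Suc d} - ?D) = 1" .
      then obtain i where "{..<Suc d} - ?D = {i}" by (auto simp: card_1_singleton_iff)
      then have "i < Suc d" "?D = {..<Suc d} - {i}" using D by blast+
      then show ?thesis using True by auto
    next
      case False
      then obtain i where "?D = {i}" using dist[OF uv] by (auto simp: card_1_singleton_iff)
      then show ?thesis using False D by auto
    qed
    then obtain i where i: "i < Suc d"
      "?D = (if {u, v} \<in> neg_edges G then {..<Suc d} - {i} else {i})" by blast
    have diff: "?\<phi> u - ?\<phi> v = (if i = d then ones_bvec d else unit_bvec i)"
      using fold_antipodes_direction[of ?D i d] i unfolding fold_antipodes_diff by (auto split: if_splits)
    have "{?\<phi> u, ?\<phi> v} \<in> edges (SPC d)"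
    proof -
      have "?\<phi> u - ?\<phi> v \<in> insert (ones_bvec d) (unit_bvec ` {..<d})"
        unfolding diff using i(1) by auto
      then show ?thesis unfolding SPC_def using fold_antipodes_in[of d] by auto
    qed
    moreover have "{?\<phi> u, ?\<phi> v} \<in> neg_edges (SPC d) \<longleftrightarrow> i = d"
      unfolding neg_edges_SPC_iff diff
      using fold_antipodes_in unit_bvec_neq_ones_bvec[OF d, of i] i(1) by auto
    moreover have "d \<in> ?D \<longleftrightarrow> ({u, v} \<in> neg_edges G \<longleftrightarrow> i \<noteq> d)"
      unfolding i(2) using i(1) by auto
    then have "t u * t v = (if {u, v} \<in> neg_edges G \<longleftrightarrow> i \<noteq> d then -1 else 1)"
      unfolding t_def by (auto split: if_splits)
    ultimately show ?thesis by (auto simp: edge_sign_def)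
  qed
  have sq: "t v * t v = 1" for v by (simp add: t_def)
  show ?thesis
    unfolding signed_hom_def
  proof (intro conjI ballI allI impI)
    show "?\<phi> ` verts G \<subseteq> verts (SPC d)" using fold_antipodes_in by (auto simp: SPC_def)
    fix e assume e: "e \<in> edges G"
    then obtain u v where "e = {u, v}" using G by (auto simp: simple_graph_def card_2_iff)
    then show "?\<phi> ` e \<in> edges (SPC d)" using edge e by simp
  next
    fix p assume p: "closed_walk G p"
    then have ne: "p \<noteq> []" "walk G p" "hd p = last p" by (auto simp: closed_walk_def walk_def)
    have "walk (SPC d) (map ?\<phi> p)"
      using ne(2) edge fold_antipodes_in by (auto simp: walk_def SPC_def)
    then show "closed_walk (SPC d) (map ?\<phi> p)"
      using ne by (simp add: closed_walk_def hd_map last_map)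
    have "walk_sign (SPC d) (map ?\<phi> p) = walk_sign G p * (t (hd p) * t (last p))"
      by (rule walk_sign_map_switching) (use edge sq ne in auto)
    then show "balanced (SPC d) (map ?\<phi> p) \<longleftrightarrow> balanced G p"
      using ne sq by (simp add: balanced_def)
  qed
qed

theorem theorem6p1:
  fixes k :: nat and G :: "'a signed_graph"
  assumes "k \<ge> 2"
    and "signed_graph G"
    and "bipartite G"
    and "unbalanced_girth G \<ge> enat (2 * k)"
    and "\<not> has_minor G (complete_graph 4)"
  shows "\<exists>\<phi>. signed_hom \<phi> G (SPC (2 * k - 1))"
proof -
  have simple: "simple_graph G" using assms(2) by (simp add: signed_graph_def)
  obtain A B where AB: "A \<inter> B = {}" "\<forall>e\<in>edges G. \<exists>a\<in>A. \<exists>b\<in>B. e = {a, b}"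
    using assms(3) unfolding bipartite_def by blast
  have "x \<in> A \<longleftrightarrow> y \<notin> A" if xy: "{x, y} \<in> edges G" for x y
  proof -
    obtain a b where "a \<in> A" "b \<in> B" "{x, y} = {a, b}" using bspec[OF AB(2) xy] by (elim bexE)
    then have "x = a \<and> y = b \<or> x = b \<and> y = a" by (simp add: doubleton_eq_iff)
    then show ?thesis using AB(1) \<open>a \<in> A\<close> \<open>b \<in> B\<close> by blast
  qed
  then interpret bipartite_of_unbalanced_girth G A k
    using simple assms by unfold_locales auto
  let ?U = "\<lparr>verts = verts G, edges = edges G\<rparr> :: 'a graph"
  have "simple_graph ?U" using simple by (simp add: simple_graph_def)
  moreover have "\<not> has_minor ?U (complete_graph 4)" using has_minor_mono[of ?U _ G] assms(5) by auto
  ultimately have "\<exists>x. (\<forall>v\<in>verts ?U. x v \<subseteq> {..<2 * k}) \<and>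
      (\<forall>u v. {u, v} \<in> edges ?U \<longrightarrow> card (sym_diff (x u) (x v)) = label u v)"
    by (rule cube_realization) (use label_sym label_le label_cube_triple in auto)
  then obtain x where x: "\<forall>v\<in>verts G. x v \<subseteq> {..<2 * k}"
    "\<forall>u v. {u, v} \<in> edges G \<longrightarrow> card (sym_diff (x u) (x v)) = label u v"
    by auto
  have "Suc (2 * k - 1) = 2 * k" using assms(1) by simp
  then have "\<And>v. v \<in> verts G \<Longrightarrow> x v \<subseteq> {..<Suc (2 * k - 1)}"
    "\<And>u v. {u, v} \<in> edges G \<Longrightarrow>
      card (sym_diff (x u) (x v)) = (if {u, v} \<in> neg_edges G then 2 * k - 1 else 1)"
    using x label_edge by simp_all
  moreover have "2 \<le> 2 * k - 1" using assms(1) by simp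
  ultimately show ?thesis using signed_hom_SPC_of_cube[of "2 * k - 1" G x] simple by blast
qed

end
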